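(* Let $A\in\mathbb{R}^{d\times n}$ have full row rank, $b\in\mathbb{R}^d$, $c\in\mathbb{R}^n$, and suppose the linear program $\min\{c^\top x:Ax=b,x\ge0\}$ has inner radius $r>0$, outer radius $R$ and Lipschitz constant $L$. Let $0<\epsilon\le\frac12$, $\overline R=\frac5\epsilon R$ and $t=2^{16}\epsilon^{-3}n^2\frac{R}{r}\cdot LR$, and consider the modified linear program with these parameters. Then: (1) the point $(x_c^+,x_c^-,\overline R)$ is on the central path of the modified program at $t$; (2) for any $x=(x^+,x^-,x^\theta)\in\mathcal{P}_{\overline R,t}$ and $s=(s^+,s^-,s^\theta)\in\mathcal{D}_{\overline R,t}$ such that $\frac56LR\le x_is_i\le\frac76LR$ for all $2n+1$ coordinates $i$, we have $(x^+-x^-,\ s^+-s^\theta\mathbf 1)\in\mathcal{P}\times\mathcal{D}$, and $x_i^-\le\epsilon x_i^+$ and $s^\theta\le\epsilon s_i^+$ for all $i\in[n]$.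
   Context: $\mathcal{P}=\{x\in\mathbb{R}^n_{\ge0}:Ax=b\}$, $\mathcal{D}=\{s\in\mathbb{R}^n_{\ge0}:A^\top y+s=c\text{ for some }y\in\mathbb{R}^d\}$. LP parameters: inner radius $r$: some $x\in\mathcal{P}$ has $x_i\ge r$ for all $i$; outer radius $R$: every $x\ge0$ with $Ax=b$ has $\|x\|_2\le R$; Lipschitz constant $L$: $\|c\|_2\le L$. Modified LP (for $\overline R\ge10R$, $t\ge 8L\overline R$): $x_c^+=\frac{t}{c+t/\overline R}$ (coordinatewise), $x_c^-=x_c^+-A^\top(AA^\top)^{-1}b$, $\widetilde c=t/x_c^-$ (coordinatewise), $\widetilde b=\sum_i x_{c,i}^++\overline R$. The modified primal program is $\min c^\top x^++\widetilde c^\top x^-$ over $\mathcal{P}_{\overline R,t}=\{(x^+,x^-,x^\theta)\in\mathbb{R}^{2n+1}_{\ge0}: A(x^+-x^-)=b,\ \sum_{i=1}^n x_i^++x^\theta=\widetilde b\}$, with dual feasible set $\mathcal{D}_{\overline R,t}=\{(s^+,s^-,s^\theta)\in\mathbb{R}^{2n+1}_{\ge0}: A^\top y+\lambda\mathbf 1+s^+=c,\ -A^\top y+s^-=\widetilde c,\ \lambda+s^\theta=0\text{ for some }y\in\mathbb{R}^d,\lambda\in\mathbb{R}\}$. A point $\overline x\in\mathbb{R}^{2n+1}$ is on the central path of the modified program at $t$ if $\overline x\in\mathcal{P}_{\overline R,t}$ with all coordinates positive and there is $\overline s\in\mathcal{D}_{\overline R,t}$ with all coordinates positive such that $\overline x_i\overline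 s_i=t$ for all $i$. *)

theory Defs
  imports "HOL-Analysis.Analysis"
begin

definition lp_primal :: "real^'n^'d \<Rightarrow> real^'d \<Rightarrow> (real^'n) set" where
  "lp_primal A b = {x. (\<forall>i. 0 \<le> x $ i) \<and> A *v x = b}"

definition lp_dual :: "real^'n^'d \<Rightarrow> real^'n \<Rightarrow> (real^'n) set" where
  "lp_dual A c = {s. (\<forall>i. 0 \<le> s $ i) \<and> (\<exists>y. transpose A *v y + s = c)}"

definition inner_radius :: "real^'n^'d \<Rightarrow> real^'d \<Rightarrow> real \<Rightarrow> bool" where
  "inner_radius A b r \<longleftrightarrow> (\<exists>x\<in>lp_primal A b. \<forall>i. r \<le> x $ i)"

definition outer_radius :: "real^'n^'d \<Rightarrow> real^'d \<Rightarrow> real \<Rightarrow> bool" where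
  "outer_radius A b R \<longleftrightarrow> (\<forall>x\<in>lp_primal A b. norm x \<le> R)"

definition lipschitz_const :: "real^'n \<Rightarrow> real \<Rightarrow> bool" where
  "lipschitz_const c L \<longleftrightarrow> norm c \<le> L"

text \<open>The modified program with parameters \<open>Rb\<close> (the enlarged radius) and \<open>t\<close>.\<close>

definition xc_plus :: "real^'n \<Rightarrow> real \<Rightarrow> real \<Rightarrow> real^'n" where
  "xc_plus c Rb t = (\<chi> i. t / (c $ i + t / Rb))"

definition xc_minus :: "real^'n^'d \<Rightarrow> real^'d \<Rightarrow> real^'n \<Rightarrow> real \<Rightarrow> real \<Rightarrow> real^'n" where
  "xc_minus A b c Rb t =
     xc_plus c Rb t - transpose A *v (matrix_inv (A ** transpose A) *v b)"

definition c_tilde :: "real^'n^'d \<Rightarrow> real^'d \<Rightarrow> real^'n \<Rightarrow> real \<Rightarrow> real \<Rightarrow> real^'n" where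
  "c_tilde A b c Rb t = (\<chi> i. t / xc_minus A b c Rb t $ i)"

definition b_tilde :: "real^'n \<Rightarrow> real \<Rightarrow> real \<Rightarrow> real" where
  "b_tilde c Rb t = (\<Sum>i\<in>UNIV. xc_plus c Rb t $ i) + Rb"

text \<open>Points of \<open>\<real>\<^sup>2\<^sup>n\<^sup>+\<^sup>1\<close> are triples of two \<open>n\<close>-vectors and a real; the following two
  combinators quantify over all \<open>2n+1\<close> coordinates of one, respectively two, such points.\<close>

type_synonym 'n point = "(real^'n) \<times> (real^'n) \<times> real"

definition all_coords :: "(real \<Rightarrow> bool) \<Rightarrow> 'n::finite point \<Rightarrow> bool" where
  "all_coords Q = (\<lambda>(xp, xm, xt). (\<forall>i. Q (xp $ i)) \<and> (\<forall>i. Q (xm $ i)) \<and> Q xt)"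

definition all_coords2 :: "(real \<Rightarrow> real \<Rightarrow> bool) \<Rightarrow> 'n::finite point \<Rightarrow> 'n point \<Rightarrow> bool" where
  "all_coords2 Q = (\<lambda>(xp, xm, xt) (sp, sm, st).
     (\<forall>i. Q (xp $ i) (sp $ i)) \<and> (\<forall>i. Q (xm $ i) (sm $ i)) \<and> Q xt st)"

definition mod_primal ::
  "real^'n^'d \<Rightarrow> real^'d \<Rightarrow> real^'n \<Rightarrow> real \<Rightarrow> real \<Rightarrow> 'n point set" where
  "mod_primal A b c Rb t = {(xp, xm, xt).
     all_coords (\<lambda>u. 0 \<le> u) (xp, xm, xt) \<and>
     A *v (xp - xm) = b \<and> (\<Sum>i\<in>UNIV. xp $ i) + xt = b_tilde c Rb t}"

definition mod_dual ::
  "real^'n^'d \<Rightarrow> real^'d \<Rightarrow> real^'n \<Rightarrow> real \<Rightarrow> real \<Rightarrow> 'n point set" where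
  "mod_dual A b c Rb t = {(sp, sm, st).
     all_coords (\<lambda>u. 0 \<le> u) (sp, sm, st) \<and>
     (\<exists>y l. transpose A *v y + vec l + sp = c \<and>
            - (transpose A *v y) + sm = c_tilde A b c Rb t \<and>
            l + st = 0)}"

text \<open>\<open>Rb\<close> and \<open>t\<close> determine the modified program; \<open>\<mu>\<close> is the position on its central path.\<close>

definition on_mod_central_path ::
  "real^'n^'d \<Rightarrow> real^'d \<Rightarrow> real^'n \<Rightarrow> real \<Rightarrow> real \<Rightarrow> real \<Rightarrow> 'n point \<Rightarrow> bool" where
  "on_mod_central_path A b c Rb t \<mu> x \<longleftrightarrow>
     x \<in> mod_primal A b c Rb t \<and> all_coords (\<lambda>u. 0 < u) x \<and>
     (\<exists>s\<in>mod_dual A b c Rb t. all_coords (\<lambda>u. 0 < u) s \<and> all_coords2 (\<lambda>u v. u * v = \<mu>) x s)"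

end

theory Submission
  imports Defs
begin

text \<open>Write \<open>c'\<close> and \<open>b'\<close> for \<open>c_tilde\<close> and \<open>b_tilde\<close>. For a feasible point \<open>x\<^sub>0\<close> of the original program with all coordinates at least \<open>r\<close>,
  the point \<open>(x\<^sub>0, 0, \<dots>)\<close> is feasible for the modified program, and orthogonality of the primal and
  dual affine spaces gives
  \<open>c \<bullet> x\<^sup>+ + c' \<bullet> x\<^sup>- + x\<^sub>0 \<bullet> s\<^sup>+ + s\<^sup>\<theta> (b' - \<Sum>x\<^sub>0) = x \<bullet> s + c \<bullet> x\<^sub>0\<close>. This identity is used twice.
  With the crude bound \<open>c \<bullet> x\<^sup>+ \<ge> -L b'\<close> it shows that \<open>x\<^sup>-\<close> is tiny because \<open>c'\<close> is huge; so
  \<open>x\<^sup>+ - x\<^sup>-\<close> is nearly feasible and, by convexity, \<open>x\<^sup>+\<close> has norm at most about \<open>R\<close>. With this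
  sharper bound on \<open>c \<bullet> x\<^sup>+\<close> the identity bounds \<open>s\<^sup>+\<close> above without any loss in \<open>\<epsilon>\<close>, hence
  \<open>x\<^sup>+\<close> below. Finally \<open>x\<^sup>\<theta> = b' - \<Sum>x\<^sup>+\<close> is at least \<open>Rb\<close>, which makes \<open>s\<^sup>\<theta>\<close> small.\<close>

section \<open>Gram matrix and least-norm solution\<close>

text \<open>Full row rank makes \<open>transpose A\<close> injective, and the quadratic form of the
  Gram matrix at \<open>v\<close> is the squared norm of \<open>transpose A *v v\<close>, so the
  kernel is trivial.\<close>

lemma invertible_gram:
  fixes A :: "real^'n^'d"
  assumes "rank A = CARD('d)"
  shows "invertible (A ** transpose A)"
proof -
  have inj: "inj ((*v) (transpose A))"
    using assms by (simp add: full_rank_injective[symmetric] rank_transpose)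
  have "v = 0" if "(A ** transpose A) *v v = 0" for v
  proof -
    have "(transpose A *v v) \<bullet> (transpose A *v v) = v \<bullet> ((A ** transpose A) *v v)"
      by (simp add: dot_lmul_matrix flip: matrix_vector_mul_assoc)
    then have "transpose A *v v = transpose A *v 0"
      using that by simp
    then show ?thesis
      using inj by (simp only: inj_eq)
  qed
  then show ?thesis
    by (simp add: invertible_left_inverse matrix_left_invertible_ker)
qed

lemma matrix_inv_right:
  fixes M :: "real^'n^'n"
  assumes "invertible M"
  shows "M ** matrix_inv M = mat 1"
  using someI_ex[OF assms[unfolded invertible_def]] by (simp add: matrix_inv_def)

text \<open>Since \<open>x\<close> lies in the range of \<open>transpose A\<close>, it has the same
  inner product with every solution; Cauchy-Schwarz on \<open>x \<bullet> x = x \<bullet> z\<close>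
  gives minimality.\<close>

lemma least_norm_solution:
  fixes A :: "real^'n^'d" and b :: "real^'d"
  defines "x \<equiv> transpose A *v (matrix_inv (A ** transpose A) *v b)"
  assumes "rank A = CARD('d)"
  shows "A *v x = b"
    and "A *v z = b \<Longrightarrow> norm x \<le> norm z"
proof -
  show Ax: "A *v x = b"
    using matrix_inv_right[OF invertible_gram[OF assms(2)]]
    by (simp only: x_def matrix_vector_mul_assoc matrix_mul_assoc matrix_vector_mul_lid)
  assume "A *v z = b"
  then have "x \<bullet> x = x \<bullet> z"
    using Ax by (simp add: x_def dot_lmul_matrix)
  also have "\<dots> \<le> norm x * norm z"
    by (rule norm_cauchy_schwarz)
  finally show "norm x \<le> norm z"
    by (simp add: dot_square_norm power2_eq_square)
       (metis mult_le_cancel_left norm_ge_zero norm_le_zero_iff not_less order.trans)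
qed

section \<open>Duality and near-feasibility\<close>

text \<open>Once \<open>sp\<close>, \<open>sm\<close> and \<open>xt\<close> are eliminated by the
  equality constraints, the terms in \<open>y\<close> cancel because \<open>A\<close> maps both
  \<open>xp - xm\<close> and \<open>z\<close> to \<open>b\<close>.\<close>

lemma duality_gap_identity:
  fixes A :: "real^'n^'d" and b :: "real^'d" and c :: "real^'n"
  assumes x: "(xp, xm, xt) \<in> mod_primal A b c Rb t"
    and s: "(sp, sm, st) \<in> mod_dual A b c Rb t"
    and z: "A *v z = b"
  shows "c \<bullet> xp + c_tilde A b c Rb t \<bullet> xm + z \<bullet> sp + st * (b_tilde c Rb t - (\<Sum>i\<in>UNIV. z $ i))
       = xp \<bullet> sp + xm \<bullet> sm + xt * st + c \<bullet> z"
proof -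
  obtain y where y: "transpose A *v y + vec (- st) + sp = c"
      "- (transpose A *v y) + sm = c_tilde A b c Rb t"
    using s by (auto simp: mod_dual_def add_eq_0_iff2)
  have sp: "sp = c - transpose A *v y + vec st"
    using y(1) by (auto simp: vec_eq_iff algebra_simps)
  have sm: "sm = c_tilde A b c Rb t + transpose A *v y"
    using y(2) by (auto simp: algebra_simps)
  have xt: "xt = b_tilde c Rb t - (\<Sum>i\<in>UNIV. xp $ i)" and Ax: "A *v (xp - xm) = b"
    using x by (auto simp: mod_primal_def)
  have vec: "u \<bullet> vec st = st * (\<Sum>i\<in>UNIV. u $ i)" for u :: "real^'n"
    by (simp add: inner_vec_def sum_distrib_left mult.commute)
  have Ay: "(transpose A *v y) \<bullet> xp - (transpose A *v y) \<bullet> xm = (transpose A *v y) \<bullet> z"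
    using Ax z by (simp add: dot_lmul_matrix matrix_vector_mult_diff_distrib flip: inner_diff_right)
  show ?thesis
    using Ay unfolding sp sm xt
    by (simp add: inner_add_right inner_diff_right inner_add_left inner_diff_left vec
          inner_commute[of xp] inner_commute[of xm] inner_commute[of z] algebra_simps)
qed

text \<open>Adding \<open>\<eta>\<close> times \<open>x0\<close> makes \<open>z\<close> nonnegative;
  the normalized mixture \<open>w\<close> is feasible, hence bounded by \<open>R\<close>, and
  solving back for \<open>z\<close> costs at most \<open>2 * \<eta> * R\<close>.\<close>

lemma norm_le_of_nearly_feasible:
  fixes A :: "real^'n^'d"
  assumes R: "outer_radius A b R"
    and x0: "x0 \<in> lp_primal A b" "\<And>i. r \<le> x0 $ i"
    and z: "A *v z = b" "\<And>i. - (\<eta> * r) \<le> z $ i"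
    and "0 \<le> \<eta>"
  shows "norm z \<le> (1 + 2 * \<eta>) * R"
proof -
  define w where "w = (1 / (1 + \<eta>)) *\<^sub>R (z + \<eta> *\<^sub>R x0)"
  have "A *v w = (1 / (1 + \<eta>)) *\<^sub>R (A *v z + \<eta> *\<^sub>R (A *v x0))"
    by (simp add: w_def matrix_vector_mult_scaleR matrix_vector_right_distrib)
  also have "\<dots> = (1 / (1 + \<eta>)) *\<^sub>R ((1 + \<eta>) *\<^sub>R b)"
    using x0(1) z(1) by (simp add: lp_primal_def scaleR_left_distrib)
  also have "\<dots> = b"
    using \<open>0 \<le> \<eta>\<close> by simp
  finally have "A *v w = b" .
  moreover have "0 \<le> w $ i" for i
  proof -
    have "\<eta> * r \<le> \<eta> * x0 $ i"
      using x0(2) \<open>0 \<le> \<eta>\<close> by (rule mult_left_mono)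
    then have "0 \<le> z $ i + \<eta> * x0 $ i"
      using z(2)[of i] by linarith
    then show ?thesis
      using \<open>0 \<le> \<eta>\<close> by (simp add: w_def)
  qed
  ultimately have w: "norm w \<le> R"
    using R by (auto simp: outer_radius_def lp_primal_def)
  have "z = (1 + \<eta>) *\<^sub>R w - \<eta> *\<^sub>R x0"
    using \<open>0 \<le> \<eta>\<close> by (simp add: w_def)
  then have "norm z \<le> (1 + \<eta>) * norm w + \<eta> * norm x0"
    using \<open>0 \<le> \<eta>\<close> norm_triangle_ineq4[of "(1 + \<eta>) *\<^sub>R w" "\<eta> *\<^sub>R x0"] by simp
  also have "\<dots> \<le> (1 + \<eta>) * R + \<eta> * R"
    using w x0(1) R \<open>0 \<le> \<eta>\<close> by (intro add_mono mult_left_mono) (auto simp: outer_radius_def)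
  finally show ?thesis
    by (simp add: algebra_simps)
qed

section \<open>The explicit central point\<close>

text \<open>With \<open>T = t / Rb\<close>, the ratio to \<open>Rb\<close> is
  \<open>T / (c $ i + T)\<close>, which lies between 20/21 and 20/19.\<close>

lemma xc_plus_bounds:
  assumes "0 < Rb" "0 < t" "\<bar>c $ i\<bar> \<le> t / Rb / 20"
  shows "9 / 10 * Rb \<le> xc_plus c Rb t $ i" "xc_plus c Rb t $ i \<le> 11 / 10 * Rb"
proof -
  define T where "T = t / Rb"
  have T: "0 < T" "t = T * Rb" "\<bar>c $ i\<bar> \<le> T / 20"
    using assms by (auto simp: T_def)
  have pos: "0 < c $ i + T"
    using T by linarith
  have eq: "xc_plus c Rb t $ i = T * Rb / (c $ i + T)"
    by (simp add: xc_plus_def flip: T_def) (simp add: T(2))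
  have "9 / 10 * (c $ i + T) \<le> T" "T \<le> 11 / 10 * (c $ i + T)"
    using T by (simp_all add: abs_le_iff)
  then have "9 / 10 * (c $ i + T) * Rb \<le> T * Rb" "T * Rb \<le> 11 / 10 * (c $ i + T) * Rb"
    using assms(1) by (intro mult_right_mono; simp)+
  then show "9 / 10 * Rb \<le> xc_plus c Rb t $ i" "xc_plus c Rb t $ i \<le> 11 / 10 * Rb"
    unfolding eq using pos by (simp_all add: pos_le_divide_eq pos_divide_le_eq mult_ac)
qed

text \<open>The shift from \<open>xc_plus\<close> is the least-norm solution, so each of its
  coordinates is at most \<open>norm z\<close> in absolute value.\<close>

lemma xc_minus_bounds:
  fixes A :: "real^'n^'d"
  assumes "rank A = CARD('d)" "0 < Rb" "0 < t" "\<bar>c $ i\<bar> \<le> t / Rb / 20"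
    and "A *v z = b" "norm z \<le> Rb / 10"
  shows "8 / 10 * Rb \<le> xc_minus A b c Rb t $ i" "xc_minus A b c Rb t $ i \<le> 12 / 10 * Rb"
proof -
  have "\<bar>(transpose A *v (matrix_inv (A ** transpose A) *v b)) $ i\<bar> \<le> Rb / 10"
    using component_le_norm_cart least_norm_solution(2)[OF assms(1,5)] assms(6)
    by (meson order.trans)
  then show "8 / 10 * Rb \<le> xc_minus A b c Rb t $ i" "xc_minus A b c Rb t $ i \<le> 12 / 10 * Rb"
    using xc_plus_bounds[of Rb t c i] assms(2-4) by (simp_all add: xc_minus_def)
qed

lemma xc_on_mod_central_path:
  fixes A :: "real^'n^'d"
  assumes "rank A = CARD('d)" "0 < Rb" "0 < t" "\<And>i. \<bar>c $ i\<bar> \<le> t / Rb / 20"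
    and "A *v z = b" "norm z \<le> Rb / 10"
  shows "on_mod_central_path A b c Rb t t (xc_plus c Rb t, xc_minus A b c Rb t, Rb)"
proof -
  let ?xp = "xc_plus c Rb t" and ?xm = "xc_minus A b c Rb t"
  define T where "T = t / Rb"
  have T: "0 < T" "Rb * T = t"
    using assms by (auto simp: T_def)
  have xp: "0 < ?xp $ i" and xm: "0 < ?xm $ i" for i
    using xc_plus_bounds(1)[OF assms(2-4)] xc_minus_bounds(1)[OF assms] \<open>0 < Rb\<close>
    by (smt (verit) mult_pos_pos divide_pos_pos)+
  have cT: "0 < c $ i + T" for i
    using assms(4)[of i] T(1) by (simp add: T_def)
  \<comment> \<open>The dual point with \<open>y = 0\<close> and \<open>\<lambda> = - T\<close>;
    \<open>xc_plus\<close> and \<open>c_tilde\<close> are defined so that all products equal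
    \<open>t\<close>.\<close>
  let ?s = "(c + vec T, c_tilde A b c Rb t, T)"
  have pos: "all_coords (\<lambda>u. 0 < u) (?xp, ?xm, Rb)" "all_coords (\<lambda>u. 0 < u) ?s"
    using xp xm cT T(1) \<open>0 < Rb\<close> \<open>0 < t\<close> by (auto simp: all_coords_def c_tilde_def)
  have nonneg: "all_coords (\<lambda>u. 0 < u) x \<Longrightarrow> all_coords (\<lambda>u. 0 \<le> u) x" for x :: "'n point"
    by (auto simp: all_coords_def less_imp_le)
  have "(?xp, ?xm, Rb) \<in> mod_primal A b c Rb t"
    using nonneg[OF pos(1)] least_norm_solution(1)[OF assms(1), of b]
    by (simp add: mod_primal_def b_tilde_def xc_minus_def)
  moreover have "?s \<in> mod_dual A b c Rb t"
    using nonneg[OF pos(2)]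
    by (auto simp: mod_dual_def vec_eq_iff intro!: exI[of _ 0] exI[of _ "- T"])
  moreover have "all_coords2 (\<lambda>u v. u * v = t) (?xp, ?xm, Rb) ?s"
  proof -
    have "?xp $ i * (c $ i + T) = t" "?xm $ i * (c_tilde A b c Rb t $ i) = t" for i
      using cT[of i] xm[of i] by (simp_all add: xc_plus_def c_tilde_def flip: T_def)
    then show ?thesis
      using T(2) by (simp add: all_coords2_def)
  qed
  ultimately show ?thesis
    using pos unfolding on_mod_central_path_def by blast
qed

theorem theorem2p9:
  fixes A :: "real^'n^'d" and b :: "real^'d" and c :: "real^'n"
    and r R L \<epsilon> Rb t :: real
  assumes "rank A = CARD('d)"
    and "inner_radius A b r" and "0 < r"
    and "outer_radius A b R"
    and "lipschitz_const c L" and "0 < L"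
    and "0 < \<epsilon>" and "\<epsilon> \<le> 1 / 2"
    and "Rb = 5 / \<epsilon> * R"
    and "t = 2 ^ 16 / \<epsilon> ^ 3 * (real CARD('n))\<^sup>2 * (R / r) * (L * R)"
  shows "on_mod_central_path A b c Rb t t (xc_plus c Rb t, xc_minus A b c Rb t, Rb) \<and>
    (\<forall>xp xm xt sp sm st.
       (xp, xm, xt) \<in> mod_primal A b c Rb t \<longrightarrow>
       (sp, sm, st) \<in> mod_dual A b c Rb t \<longrightarrow>
       all_coords2 (\<lambda>u v. 5 / 6 * (L * R) \<le> u * v \<and> u * v \<le> 7 / 6 * (L * R))
         (xp, xm, xt) (sp, sm, st) \<longrightarrow>
       (xp - xm, sp - vec st) \<in> lp_primal A b \<times> lp_dual A c \<and>
       (\<forall>i. xm $ i \<le> \<epsilon> * xp $ i \<and> st \<le> \<epsilon> * sp $ i))"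
proof -

  \<comment> \<open>Size of the parameters\<close>
  define N where "N = real CARD('n)"
  define T where "T = t / Rb"
  have N: "1 \<le> N"
    by (simp add: N_def Suc_le_eq)
  obtain x0 where x0: "x0 \<in> lp_primal A b" "\<And>i. r \<le> x0 $ i"
    using \<open>inner_radius A b r\<close> by (auto simp: inner_radius_def)
  have Ax0: "A *v x0 = b" and x0R: "norm x0 \<le> R"
    using x0(1) \<open>outer_radius A b R\<close> by (auto simp: lp_primal_def outer_radius_def)
  have x0_le: "x0 $ i \<le> R" for i
    using component_le_norm_cart[of x0 i] x0R by linarith
  have rR: "r \<le> R" and R: "0 < R"
    using x0(2) x0_le \<open>0 < r\<close> by (meson order.trans less_le_trans)+
  have Rb: "10 * R \<le> Rb" "0 < Rb" "Rb * \<epsilon> = 5 * R"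
    using assms(7-9) R mult_right_mono[of 2 "1 / \<epsilon>" "5 * R"] by (auto simp: le_divide_eq)
  have T_eq: "T = 2 ^ 16 / 5 * ((1 / \<epsilon>)\<^sup>2 * N\<^sup>2 * (R / r)) * L"
    using R \<open>0 < \<epsilon>\<close> \<open>0 < r\<close>
    by (simp add: T_def assms(9,10) N_def field_simps power2_eq_square power3_eq_cube)
  have LT: "20 * L \<le> T"
  proof -
    \<comment> \<open>Every factor of \<open>\<kappa>\<close> is at least 1, and
      \<open>2 ^ 16 / 5\<close> exceeds 20.\<close>
    define \<kappa> where "\<kappa> = (1 / \<epsilon>)\<^sup>2 * N\<^sup>2 * (R / r)"
    have "1 \<le> \<kappa>"
      unfolding \<kappa>_def using assms(3,7,8) rR N
      by (intro mult_ge1_I one_le_power) (auto simp: field_simps)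
    then show ?thesis
      unfolding T_eq \<kappa>_def[symmetric] using \<open>0 < L\<close> by (intro mult_right_mono) auto
  qed
  have "0 < T"
    using LT \<open>0 < L\<close> by linarith
  then have t: "0 < t"
    using Rb(2) by (simp add: T_def zero_less_divide_iff)
  have cL: "norm c \<le> L" "\<bar>c $ i\<bar> \<le> L" for i
    using \<open>lipschitz_const c L\<close> component_le_norm_cart[of c i] by (auto simp: lipschitz_const_def)
  have c20: "\<bar>c $ i\<bar> \<le> t / Rb / 20" for i
    using cL(2)[of i] LT by (simp add: T_def)
  have x0Rb: "norm x0 \<le> Rb / 10"
    using x0R Rb(1) by linarith
  note xp_bounds = xc_plus_bounds[OF Rb(2) t c20]
  note xm_bounds = xc_minus_bounds[OF assms(1) Rb(2) t c20 Ax0 x0Rb]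
  let ?ct = "c_tilde A b c Rb t" and ?bt = "b_tilde c Rb t"
  have bt: "(9 / 10 * N + 1) * Rb \<le> ?bt" "?bt \<le> (11 / 10 * N + 1) * Rb"
    using sum_mono[of UNIV "\<lambda>_. 9 / 10 * Rb" "($) (xc_plus c Rb t)"]
      sum_mono[of UNIV "($) (xc_plus c Rb t)" "\<lambda>_. 11 / 10 * Rb"] xp_bounds
    by (auto simp: b_tilde_def N_def algebra_simps)
  have ct: "T / (12 / 10) \<le> ?ct $ i" for i
  proof -
    have "0 < xc_minus A b c Rb t $ i"
      using xm_bounds(1)[of i] Rb(2) by linarith
    then have "t / (12 / 10 * Rb) \<le> t / xc_minus A b c Rb t $ i"
      using xm_bounds(2)[of i] t by (intro divide_left_mono) (auto intro: mult_pos_pos Rb(2))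
    then show ?thesis
      using Rb(2) by (simp add: c_tilde_def T_def field_simps)
  qed
  have LRN: "L * R \<le> N * (L * R)"
    using N R \<open>0 < L\<close> by simp
  have cs: "c \<bullet> u \<le> L * norm u" "- (L * norm u) \<le> c \<bullet> u" for u
    using Cauchy_Schwarz_ineq2[of c u] mult_right_mono[OF cL(1) norm_ge_zero[of u]]
    by linarith+
  have bt_x0: "0 \<le> ?bt - (\<Sum>i\<in>UNIV. x0 $ i)"
  proof -
    have "(\<Sum>i\<in>UNIV. x0 $ i) \<le> N * R"
      using sum_mono[of UNIV "($) x0" "\<lambda>_. R"] x0_le by (simp add: N_def)
    also have "\<dots> \<le> N * (9 / 10 * Rb)"
      using N Rb(1) R by (intro mult_left_mono) auto
    finally show ?thesis
      using bt(1) Rb(2) by (simp add: algebra_simps)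
  qed

  \<comment> \<open>Points with all products near \<open>L * R\<close>\<close>
  have "(xp - xm, sp - vec st) \<in> lp_primal A b \<times> lp_dual A c \<and>
       (\<forall>i. xm $ i \<le> \<epsilon> * xp $ i \<and> st \<le> \<epsilon> * sp $ i)"
    if x: "(xp, xm, xt) \<in> mod_primal A b c Rb t"
      and s: "(sp, sm, st) \<in> mod_dual A b c Rb t"
      and xs: "all_coords2 (\<lambda>u v. 5 / 6 * (L * R) \<le> u * v \<and> u * v \<le> 7 / 6 * (L * R))
         (xp, xm, xt) (sp, sm, st)" for xp xm xt sp sm st
  proof -
    have nonneg: "0 \<le> xp $ i" "0 \<le> xm $ i" "0 \<le> xt" "0 \<le> sp $ i" "0 \<le> sm $ i" "0 \<le> st" for i
      using x s by (auto simp: mod_primal_def mod_dual_def all_coords_def)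
    have Axm: "A *v (xp - xm) = b" and xt: "(\<Sum>i\<in>UNIV. xp $ i) + xt = ?bt"
      using x by (auto simp: mod_primal_def)
    have prod_ge: "5 / 6 * (L * R) \<le> xp $ i * sp $ i"
      and prod_le: "xp $ i * sp $ i \<le> 7 / 6 * (L * R)" "xm $ i * sm $ i \<le> 7 / 6 * (L * R)"
        "xt * st \<le> 7 / 6 * (L * R)" for i
      using xs by (auto simp: all_coords2_def)
    have "xp \<bullet> sp \<le> N * (7 / 6 * (L * R))" "xm \<bullet> sm \<le> N * (7 / 6 * (L * R))"
      using sum_mono[of UNIV "\<lambda>i. xp $ i * sp $ i" "\<lambda>_. 7 / 6 * (L * R)"]
        sum_mono[of UNIV "\<lambda>i. xm $ i * sm $ i" "\<lambda>_. 7 / 6 * (L * R)"] prod_le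
      by (simp_all add: inner_vec_def N_def)
    \<comment> \<open>The constant is three times 7/6 for the products plus 1 for
      \<open>c \<bullet> x0\<close>; the nonnegative term in \<open>st\<close> is dropped.\<close>
    then have gap: "c \<bullet> xp + ?ct \<bullet> xm + x0 \<bullet> sp \<le> 9 / 2 * (N * (L * R))"
      using duality_gap_identity[OF x s Ax0] mult_nonneg_nonneg[OF nonneg(6) bt_x0] prod_le(3)
        cs(1)[of x0] mult_left_mono[OF x0R, of L] LRN \<open>0 < L\<close>
      by linarith
    have ct_nonneg: "0 \<le> ?ct $ i" for i
      using ct[of i] LT \<open>0 < L\<close> by (smt (verit) divide_nonneg_nonneg)
    have ct_xm: "?ct $ i * xm $ i \<le> ?ct \<bullet> xm" for i
      unfolding inner_vec_def using ct_nonneg nonneg by (auto intro!: member_le_sum)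
    have x0_nonneg: "0 \<le> x0 $ i" for i
      using x0(2)[of i] \<open>0 < r\<close> by linarith
    have x0_sp: "r * sp $ i \<le> x0 \<bullet> sp" for i
    proof -
      have "r * sp $ i \<le> x0 $ i * sp $ i"
        using x0(2) nonneg by (intro mult_right_mono)
      also have "\<dots> \<le> x0 \<bullet> sp"
        unfolding inner_vec_def using x0_nonneg nonneg by (auto intro!: member_le_sum)
      finally show ?thesis .
    qed
    have sp_nonneg: "0 \<le> x0 \<bullet> sp" and ctxm_nonneg: "0 \<le> ?ct \<bullet> xm"
      unfolding inner_vec_def using x0_nonneg ct_nonneg nonneg by (auto intro!: sum_nonneg)

    have xm_small: "xm $ i \<le> \<epsilon> * r / N / 500" for i
    proof -
      have "- (L * ?bt) \<le> c \<bullet> xp"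
      proof -
        have "norm xp \<le> (\<Sum>i\<in>UNIV. xp $ i)"
          using norm_le_l1_cart[of xp] nonneg by simp
        then have "L * norm xp \<le> L * ?bt"
          using xt nonneg(3) \<open>0 < L\<close> by (intro mult_left_mono) auto
        then show ?thesis
          using cs(2)[of xp] by linarith
      qed
      moreover have "L * ?bt \<le> 21 / 2 * (N * (L * R) / \<epsilon>)"
      proof -
        have "?bt \<le> (21 / 10 * N) * Rb"
          using bt(2) mult_right_mono[of "11 / 10 * N + 1" "21 / 10 * N" Rb] N Rb(2) by linarith
        then have "L * ?bt \<le> L * ((21 / 10 * N) * Rb)"
          using \<open>0 < L\<close> by (intro mult_left_mono) auto
        then show ?thesis
          by (simp add: assms(9) mult_ac)
      qed
      moreover have "N * (L * R) \<le> 1 / 2 * (N * (L * R) / \<epsilon>)"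
        using assms(6-8) N R mult_left_mono[of "2 * \<epsilon>" 1 "N * (L * R)"]
        by (simp add: field_simps)
      \<comment> \<open>21/2 from the crude bound on \<open>c \<bullet> xp\<close>, plus half of 9/2
        from \<open>gap\<close>.\<close>
      ultimately have "?ct $ i * xm $ i \<le> 51 / 4 * (N * (L * R) / \<epsilon>)"
        using gap ct_xm[of i] sp_nonneg by linarith
      moreover have "T * xm $ i \<le> 12 / 10 * (?ct $ i * xm $ i)"
        using mult_right_mono[OF ct nonneg(2), of i i] by simp
      moreover have "0 \<le> N * (L * R) / \<epsilon>"
        using assms(6,7) N R by simp
      \<comment> \<open>The constant is rounded up from 15.3 so that \<open>T\<close> factors out
        exactly.\<close>
      ultimately have "T * xm $ i \<le> 65536 / 2500 * (N * (L * R) / \<epsilon>)"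
        by linarith
      also have "\<dots> = T * (\<epsilon> * r / N / 500)"
        using N assms(3,7) by (simp add: T_eq field_simps power2_eq_square)
      finally show ?thesis
        using \<open>0 < T\<close> by (rule mult_left_le_imp_le)
    qed
    have "\<epsilon> * r / N / 500 \<le> 1 / 1000 * r"
    proof -
      have "(2 * \<epsilon>) * r \<le> N * r"
        using N assms(3,8) by (intro mult_right_mono) auto
      then show ?thesis
        using N by (simp add: field_simps)
    qed
    then have xm_small': "xm $ i \<le> 1 / 1000 * r" for i
      using xm_small order.trans by blast
    have norm_xp: "norm xp \<le> 21 / 20 * R"
    proof -
      \<comment> \<open>Near-feasibility with \<open>\<eta> = 1 / 1000\<close>, supplied by
        \<open>xm_small'\<close>.\<close>
      have "norm (xp - xm) \<le> (1 + 2 * (1 / 1000)) * R"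
      proof (rule norm_le_of_nearly_feasible[OF assms(4) x0 Axm])
        show "- (1 / 1000 * r) \<le> (xp - xm) $ i" for i
          using xm_small'[of i] nonneg(1)[of i] by simp
      qed simp
      moreover have "norm xm \<le> R / 1000"
      proof -
        have "norm xm \<le> (\<Sum>i\<in>UNIV. xm $ i)"
          using norm_le_l1_cart[of xm] nonneg by simp
        also have "\<dots> \<le> N * (\<epsilon> * r / N / 500)"
          using sum_mono[of UNIV "($) xm" "\<lambda>_. \<epsilon> * r / N / 500"] xm_small by (simp add: N_def)
        also have "\<dots> = \<epsilon> * r / 500"
          using N by simp
        also have "\<dots> \<le> R / 1000"
          using mult_mono[of \<epsilon> "1 / 2" r R] assms(3,7,8) rR by simp
        finally show ?thesis .
      qed
      ultimately show ?thesis
        using norm_triangle_ineq[of "xp - xm" xm] R by simp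
    qed
    have xp_le: "xp $ i \<le> 21 / 20 * R" for i
      using component_le_norm_cart[of xp i] norm_xp by linarith
    have xp_pos: "0 < xp $ i" and sp_pos: "0 < sp $ i" for i
    proof -
      have "0 < xp $ i * sp $ i"
        using prod_ge[of i] mult_pos_pos[OF \<open>0 < L\<close> R] by linarith
      then show "0 < xp $ i" "0 < sp $ i"
        using nonneg(1,4)[of i] by (auto simp: zero_less_mult_iff)
    qed
    have xm_xp: "xm $ i \<le> \<epsilon> * xp $ i" for i
    proof -
      have "L * norm xp \<le> 21 / 20 * (N * (L * R))"
        using mult_left_mono[OF norm_xp, of L] LRN \<open>0 < L\<close> by simp
      \<comment> \<open>Here 6 rounds up 9/2 + 21/20. The bound on \<open>c \<bullet> xp\<close> now
        involves \<open>R\<close> instead of \<open>Rb\<close>, so no factor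
        \<open>1 / \<epsilon>\<close> appears.\<close>
      then have "r * sp $ i \<le> 6 * (N * (L * R))"
        using gap cs(2)[of xp] ctxm_nonneg x0_sp[of i] LRN mult_pos_pos[OF \<open>0 < L\<close> R] by linarith
      then have "xp $ i * (r * sp $ i) \<le> xp $ i * (6 * (N * (L * R)))"
        using nonneg by (intro mult_left_mono)
      moreover have "r * (5 / 6 * (L * R)) \<le> r * (xp $ i * sp $ i)"
        using prod_ge \<open>0 < r\<close> by (intro mult_left_mono) auto
      ultimately have "(L * R) * (r * (5 / 36)) \<le> (L * R) * (xp $ i * N)"
        by (simp add: algebra_simps)
      then have "r * (5 / 36) \<le> xp $ i * N"
        using mult_pos_pos[OF \<open>0 < L\<close> R] by (rule mult_left_le_imp_le)
      then have "r / N / 500 \<le> xp $ i"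
        using N \<open>0 < r\<close> by (simp add: field_simps)
      then have "\<epsilon> * (r / N / 500) \<le> \<epsilon> * xp $ i"
        using assms(7) by (intro mult_left_mono) auto
      then show ?thesis
        using xm_small[of i] by simp
    qed
    have st_le: "st \<le> \<epsilon> * L * (7 / 30)"
    proof -
      have "(\<Sum>i\<in>UNIV. xp $ i) \<le> N * (21 / 20 * R)"
        using sum_mono[of UNIV "($) xp" "\<lambda>_. 21 / 20 * R"] xp_le by (simp add: N_def)
      also have "\<dots> \<le> N * (9 / 10 * Rb)"
        using Rb(1) R N by (intro mult_left_mono) auto
      \<comment> \<open>\<open>?bt\<close> exceeds the bound on the sum of \<open>xp\<close> by the
        extra summand \<open>Rb\<close> of \<open>b_tilde\<close>.\<close>
      finally have "Rb \<le> xt"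
        using xt bt(1) by (simp add: algebra_simps)
      then have "Rb * st \<le> 7 / 6 * (L * R)"
        using mult_right_mono[OF _ nonneg(6), of Rb xt] prod_le(3) by linarith
      also have "\<dots> = Rb * (\<epsilon> * L * (7 / 30))"
        using Rb(3) by (simp add: algebra_simps)
      finally show ?thesis
        using Rb(2) by (rule mult_left_le_imp_le)
    qed
    have st_sp: "st \<le> \<epsilon> * sp $ i" for i
    proof -
      have "5 / 6 * (L * R) \<le> (21 / 20 * R) * sp $ i"
        using prod_ge[of i] mult_right_mono[OF xp_le nonneg(4), of i i] by linarith
      \<comment> \<open>The available factor 50/63 is weakened to 7/30 to match
        \<open>st_le\<close>.\<close>
      then have "R * (L * (7 / 30)) \<le> R * sp $ i"
        using mult_pos_pos[OF \<open>0 < L\<close> R] by (simp add: algebra_simps)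
      then have "L * (7 / 30) \<le> sp $ i"
        using R by (rule mult_left_le_imp_le)
      then have "\<epsilon> * (L * (7 / 30)) \<le> \<epsilon> * sp $ i"
        using assms(7) by (intro mult_left_mono) auto
      then show ?thesis
        using st_le by simp
    qed
    \<comment> \<open>Turns the two \<open>\<epsilon>\<close>-bounds into nonnegativity of
      \<open>xp - xm\<close> and \<open>sp - vec st\<close>.\<close>
    have eps: "\<epsilon> * u \<le> u" if "0 < u" for u
      using that assms(8) by simp
    have "xp - xm \<in> lp_primal A b"
      using Axm order.trans[OF xm_xp eps[OF xp_pos]] by (auto simp: lp_primal_def)
    moreover have "sp - vec st \<in> lp_dual A c"
    proof -
      obtain y where "transpose A *v y + vec (- st) + sp = c"
        using s by (auto simp: mod_dual_def add_eq_0_iff2)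
      then have "transpose A *v y + (sp - vec st) = c"
        by (auto simp: vec_eq_iff algebra_simps)
      then show ?thesis
        using order.trans[OF st_sp eps[OF sp_pos]] by (auto simp: lp_dual_def)
    qed
    ultimately show ?thesis
      using xm_xp st_sp by blast
  qed
  then show ?thesis
    using xc_on_mod_central_path[OF assms(1) Rb(2) t c20 Ax0 x0Rb] by blast
qed

end
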